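(* Let $R$ be a non-trivial commutative ring with unity and let $g(t)=t^n+\sum_{k=0}^{n-1}g_kt^k\in R[t]$ be monic of degree $n$. Let $Q_g=R[t]/\langle g(t)\rangle$ and let $R_g\subseteq R^{n\times n}$ be the companion ring of $g(t)$. Then the map $\mathcal{M}:Q_g\to R_g$ given by $$[f(t)]=\sum_{k=0}^{n-1}f_k[t^k]\ \mapsto\ \mathcal{M}([f(t)])=\sum_{k=0}^{n-1}f_kC_g^k=f(C_g)$$ is a ring isomorphism.
   Context: The companion matrix $C_g\in R^{n\times n}$ of $g(t)=t^n+\sum_{k=0}^{n-1}g_kt^k$ has first row $(-g_{n-1},\dots,-g_1,-g_0)$, entries $1$ in positions $(i+1,i)$ for $1\le i\le n-1$, and $0$ elsewhere. The companion ring $R_g$ is the commutative ring, under the usual matrix addition and multiplication, of all matrices in $R^{n\times n}$ that are polynomials in $C_g$ with coefficients in $R$. For $f(t)\in R[t]$, $[f(t)]\in Q_g$ denotes its class modulo the ideal generated by $g(t)$, and $f_0,\dots,f_{n-1}\in R$ are the coefficients of $[f(t)]$ in the monomial basis $[1],[t],\dots,[t^{n-1}]$ of $Q_g$, i.e. $f(t)\equiv\sum_{k=0}^{n-1}f_kt^k \bmod g(t)$. The matrix $f(C_g)$ is the evaluation of the polynomial $f$ at $C_g$. *)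

theory Defs
  imports
    "HOL-Computational_Algebra.Polynomial"
    "HOL-Algebra.QuotRing"
    "Jordan_Normal_Form.Matrix"
begin

text \<open>The coefficient ring is a type of class \<^class>\<open>comm_ring_1\<close> (which includes
  \<open>0 \<noteq> 1\<close>); \<open>poly_ring\<close> repackages its polynomial type as a record, so that ideals
  and quotients of \<^theory>\<open>HOL-Algebra.QuotRing\<close> apply.\<close>

definition poly_ring :: "'a::comm_ring_1 poly ring" where
  "poly_ring = \<lparr>carrier = UNIV, mult = (*), one = 1, zero = 0, add = (+)\<rparr>"

definition poly_quot :: "'a::comm_ring_1 poly \<Rightarrow> 'a poly set ring" where
  "poly_quot g = poly_ring Quot (genideal poly_ring {g})"

definition residue_class :: "'a::comm_ring_1 poly \<Rightarrow> 'a poly \<Rightarrow> 'a poly set" where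
  "residue_class g f = genideal poly_ring {g} +>\<^bsub>poly_ring\<^esub> f"

text \<open>The coordinates of a class \<open>X\<close> in the monomial basis: the coefficients of its
  representative of degree less than \<open>degree g\<close>, which is unique for monic \<open>g\<close>. The degree bound
  is phrased through coefficients so that it also makes sense for \<open>degree g = 0\<close>, where it
  forces \<open>r = 0\<close>.\<close>

definition quot_coeff :: "'a::comm_ring_1 poly \<Rightarrow> 'a poly set \<Rightarrow> nat \<Rightarrow> 'a" where
  "quot_coeff g X = coeff (THE r. r \<in> X \<and> (\<forall>k\<ge>degree g. coeff r k = 0))"

text \<open>Matrix indices start at 0: the first row is \<open>i = 0\<close>.\<close>

definition companion_mat :: "'a::comm_ring_1 poly \<Rightarrow> 'a mat" where
  "companion_mat g = mat (degree g) (degree g) (\<lambda>(i, j).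
     if i = 0 then - coeff g (degree g - 1 - j)
     else if i = j + 1 then 1
     else 0)"

definition eval_mat :: "'a::comm_ring_1 poly \<Rightarrow> 'a mat \<Rightarrow> 'a mat" where
  "eval_mat f A = (\<Oplus>\<^bsub>ring_mat TYPE('a) (dim_row A) ()\<^esub>k\<in>{..degree f}. coeff f k \<cdot>\<^sub>m (A ^\<^sub>m k))"

definition companion_ring :: "'a::comm_ring_1 poly \<Rightarrow> 'a mat ring" where
  "companion_ring g = (ring_mat TYPE('a) (degree g) ())
     \<lparr>carrier := {eval_mat f (companion_mat g) | f. True}\<rparr>"

definition companion_map :: "'a::comm_ring_1 poly \<Rightarrow> 'a poly set \<Rightarrow> 'a mat" where
  "companion_map g X = (\<Oplus>\<^bsub>ring_mat TYPE('a) (degree g) ()\<^esub>k\<in>{..<degree g}.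
     quot_coeff g X k \<cdot>\<^sub>m (companion_mat g ^\<^sub>m k))"

end

theory Submission
  imports Defs
begin

text \<open>
  Write \<open>C\<close> for the companion matrix of \<open>g\<close> and \<open>n\<close> for the degree of \<open>g\<close>. Evaluation
  \<open>f \<mapsto> f(C)\<close> is a ring homomorphism from the polynomials onto the companion ring, so by the first
  isomorphism theorem everything reduces to the claim that its kernel is the ideal generated by
  \<open>g\<close> (\<open>eval_companion_mat_eq_0_iff\<close>).

  The kernel is read off from the last row. Let \<open>e_i\<close> denote the standard row vectors, with
  indices starting at 0. Below the first row, \<open>C\<close> has the rows of the identity shifted down by one,
  so \<open>e_(n-1) C^k = e_(n-1-k)\<close> for \<open>k < n\<close>. Two things follow.

  \<^item> If \<open>r = r_0 + \<dots> + r_(n-1) t^(n-1)\<close>, then the last row of \<open>r(C)\<close> consists of the coefficients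
    of \<open>r\<close> in reverse order. Hence \<open>r(C) = 0\<close> forces \<open>r = 0\<close>.
  \<^item> The last row of \<open>C^n\<close> is \<open>e_0 C\<close>, the first row of \<open>C\<close>, and it cancels the contribution of
    the lower coefficients of \<open>g\<close>; so \<open>e_(n-1) g(C) = 0\<close>. As \<open>g(C)\<close> commutes with \<open>C\<close>,
    \<open>e_(n-1-k) g(C) = e_(n-1) C^k g(C) = e_(n-1) g(C) C^k = 0\<close> for every \<open>k < n\<close>, whence
    \<open>g(C) = 0\<close>. This replaces an appeal to the Cayley-Hamilton theorem.

  Division with remainder by the monic polynomial \<open>g\<close> turns these into the kernel claim. The first
  fact also makes the remainder in a residue class unique, so that the coordinates in the monomial
  basis are well defined, and the map given by these coordinates is the one induced by evaluation.
\<close>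

section \<open>The quotient of the polynomial ring by a principal ideal\<close>

lemma poly_ring_simps:
  "carrier poly_ring = UNIV" "mult poly_ring = (*)" "one poly_ring = 1"
  "zero poly_ring = 0" "add poly_ring = (+)"
  by (simp_all add: poly_ring_def)

lemma cring_poly_ring: "cring (poly_ring :: 'a::comm_ring_1 poly ring)"
proof (rule cringI)
  show "abelian_group (poly_ring :: 'a poly ring)"
  proof (rule abelian_groupI)
    fix x :: "'a poly"
    show "\<exists>y\<in>carrier poly_ring. y \<oplus>\<^bsub>poly_ring\<^esub> x = \<zero>\<^bsub>poly_ring\<^esub>"
      by (rule bexI[of _ "- x"]) (simp_all add: poly_ring_simps)
  qed (simp_all add: poly_ring_simps ac_simps)
  show "comm_monoid (poly_ring :: 'a poly ring)"
    by (rule comm_monoidI) (auto simp: poly_ring_simps ac_simps)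
qed (simp add: poly_ring_simps distrib_right)

lemma genideal_poly_ring:
  "genideal poly_ring {g :: 'a::comm_ring_1 poly} = {f. g dvd f}"
proof -
  interpret cring "poly_ring :: 'a poly ring" by (rule cring_poly_ring)
  have "genideal poly_ring {g} = cgenideal poly_ring g"
    using cgenideal_eq_genideal[of g] by (simp add: poly_ring_simps)
  then show ?thesis
    by (auto simp: cgenideal_def poly_ring_simps dvd_def mult.commute)
qed

lemma mem_residue_class_iff: "r \<in> residue_class g f \<longleftrightarrow> g dvd (r - f)"
proof -
  have "r \<in> residue_class g f \<longleftrightarrow> (\<exists>h. g dvd h \<and> r = h + f)"
    by (auto simp: residue_class_def genideal_poly_ring a_r_coset_def' poly_ring_simps)
  also have "\<dots> \<longleftrightarrow> g dvd (r - f)"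
  proof
    assume "g dvd (r - f)"
    then show "\<exists>h. g dvd h \<and> r = h + f"
      by (intro exI[of _ "r - f"]) simp
  qed auto
  finally show ?thesis .
qed

lemma residue_class_eq_iff: "residue_class g f = residue_class g h \<longleftrightarrow> g dvd (f - h)"
proof
  assume "residue_class g f = residue_class g h"
  then show "g dvd (f - h)"
    using mem_residue_class_iff[of f g f] mem_residue_class_iff[of f g h] by simp
next
  assume d: "g dvd (f - h)"
  have "r \<in> residue_class g f \<longleftrightarrow> r \<in> residue_class g h" for r
    using dvd_add_left_iff[OF d, of "r - f"] by (simp add: mem_residue_class_iff)
  then show "residue_class g f = residue_class g h"
    by blast
qed

text \<open>For a monic divisor, pseudo-division multiplies the dividend by a power of 1 and hence is
  ordinary division, over any commutative ring. The bound on the remainder is stated through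
  coefficients so that it forces \<open>r = 0\<close> when \<open>g\<close> has degree 0.\<close>

lemma monic_division_exists:
  fixes f g :: "'a::comm_ring_1 poly"
  assumes "lead_coeff g = 1"
  obtains q r where "f = g * q + r" "\<forall>k\<ge>degree g. coeff r k = 0"
proof -
  obtain q r where qr: "pseudo_divmod f g = (q, r)" by (rule prod.exhaust)
  have g0: "g \<noteq> 0"
  proof
    assume "g = 0"
    with assms show False by simp
  qed
  have "f = g * q + r"
    using pseudo_divmod(1)[OF g0 qr] assms by simp
  moreover have "coeff r k = 0" if "k \<ge> degree g" for k
    using pseudo_divmod(2)[OF g0 qr] coeff_eq_0[of r k] that by (cases "r = 0") simp_all
  ultimately show ?thesis using that by blast
qed

section \<open>Evaluation of polynomials at a square matrix\<close>

lemma finsum_ring_mat: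
  fixes B :: "'b \<Rightarrow> 'a::comm_ring_1 mat"
  assumes "finite F" "\<And>k. k \<in> F \<Longrightarrow> B k \<in> carrier_mat n n"
  shows "finsum (ring_mat TYPE('a) n ()) B F
    = mat n n (\<lambda>(i, j). \<Sum>k\<in>F. B k $$ (i, j))"
proof -
  interpret ring "ring_mat TYPE('a) n ()" by (rule ring_mat)
  show ?thesis using assms
  proof (induction F rule: finite_induct)
    case empty
    show ?case by (auto simp: ring_mat_simps)
  next
    case (insert x F)
    have "finsum (ring_mat TYPE('a) n ()) B (insert x F)
        = B x + finsum (ring_mat TYPE('a) n ()) B F"
      using insert by (subst finsum_insert) (auto simp: ring_mat_simps)
    also have "\<dots> = mat n n (\<lambda>(i, j). \<Sum>k\<in>insert x F. B k $$ (i, j))"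
      using insert by (intro eq_matI) (auto simp: insert.IH)
    finally show ?case .
  qed
qed

text \<open>The free upper limit \<open>N\<close> lets polynomials of different degrees be compared as sums over
  the same range.\<close>

lemma eval_mat_eq_mat:
  fixes A :: "'a::comm_ring_1 mat"
  assumes "A \<in> carrier_mat n n" "\<forall>k>N. coeff f k = 0"
  shows "eval_mat f A = mat n n (\<lambda>(i, j). \<Sum>k\<le>N. coeff f k * (A ^\<^sub>m k) $$ (i, j))"
proof -
  have "(\<Sum>k\<le>degree f. coeff f k * (A ^\<^sub>m k) $$ (i, j))
      = (\<Sum>k\<le>N. coeff f k * (A ^\<^sub>m k) $$ (i, j))" for i j
  proof -
    have "(\<Sum>k\<le>degree f. coeff f k * (A ^\<^sub>m k) $$ (i, j))
        = (\<Sum>k\<in>{..degree f} \<union> {..N}. coeff f k * (A ^\<^sub>m k) $$ (i, j))"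
      by (rule sum.mono_neutral_left) (auto simp: coeff_eq_0)
    also have "\<dots> = (\<Sum>k\<le>N. coeff f k * (A ^\<^sub>m k) $$ (i, j))"
      using assms(2) by (intro sum.mono_neutral_right) (auto simp: not_le)
    finally show ?thesis .
  qed
  then show ?thesis
    using assms(1) unfolding eval_mat_def
    by (subst finsum_ring_mat) (auto intro!: eq_matI)
qed

lemma eval_mat_carrier [simp]: "A \<in> carrier_mat n n \<Longrightarrow> eval_mat f A \<in> carrier_mat n n"
  by (subst eval_mat_eq_mat[where N = "degree f" and n = n]) (auto simp: coeff_eq_0)

lemma eval_mat_dims:
  assumes "A \<in> carrier_mat n n"
  shows "dim_row (eval_mat f A) = n" "dim_col (eval_mat f A) = n"
  using eval_mat_carrier[OF assms] by blast+

lemma eval_mat_add: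
  assumes A: "A \<in> carrier_mat n n"
  shows "eval_mat (p + q) A = eval_mat p A + eval_mat q A"
proof -
  define N where "N = max (degree p) (degree q)"
  have *: "\<forall>k>N. coeff p k = 0" "\<forall>k>N. coeff q k = 0" "\<forall>k>N. coeff (p + q) k = 0"
    by (auto simp: N_def coeff_eq_0)
  show ?thesis
    unfolding eval_mat_eq_mat[OF A *(1)] eval_mat_eq_mat[OF A *(2)] eval_mat_eq_mat[OF A *(3)]
    by (rule eq_matI) (simp_all add: sum.distrib distrib_right)
qed

lemma eval_mat_smult:
  assumes A: "A \<in> carrier_mat n n"
  shows "eval_mat (Polynomial.smult a p) A = a \<cdot>\<^sub>m eval_mat p A"
  by (rule eq_matI)
     (auto simp: eval_mat_eq_mat[OF A, of "degree p"] coeff_eq_0 sum_distrib_left mult.assoc)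

text \<open>The Horner step. It reduces multiplicativity to an induction over the second factor.\<close>

lemma eval_mat_pCons:
  assumes A: "A \<in> carrier_mat n n"
  shows "eval_mat (pCons a p) A = a \<cdot>\<^sub>m 1\<^sub>m n + eval_mat p A * A"
proof -
  have *: "\<forall>k>Suc (degree p). coeff (pCons a p) k = 0"
    by (auto simp: coeff_pCons coeff_eq_0 split: nat.split)
  have **: "\<forall>k>degree p. coeff p k = 0"
    by (auto simp: coeff_eq_0)
  show ?thesis
  proof (rule eq_matI, goal_cases)
    case (1 i j)
    then have ij: "i < n" "j < n" using A by (auto simp: eval_mat_dims[OF A])
    have "eval_mat (pCons a p) A $$ (i, j)
        = (\<Sum>k\<le>Suc (degree p). coeff (pCons a p) k * (A ^\<^sub>m k) $$ (i, j))"
      using ij by (simp add: eval_mat_eq_mat[OF A *])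
    also have "\<dots> = a * (1\<^sub>m n) $$ (i, j)
        + (\<Sum>k\<le>degree p. coeff p k * (A ^\<^sub>m k * A) $$ (i, j))"
      using A by (subst sum.atMost_Suc_shift) simp
    also have "(\<Sum>k\<le>degree p. coeff p k * (A ^\<^sub>m k * A) $$ (i, j))
        = (\<Sum>k\<le>degree p. \<Sum>l<n. coeff p k * (A ^\<^sub>m k) $$ (i, l) * A $$ (l, j))"
      using A ij by (simp add: scalar_prod_def sum_distrib_left mult.assoc atLeast0LessThan)
    also have "\<dots> = (\<Sum>l<n. (\<Sum>k\<le>degree p. coeff p k * (A ^\<^sub>m k) $$ (i, l)) * A $$ (l, j))"
      by (subst sum.swap) (simp add: sum_distrib_right)
    also have "\<dots> = (eval_mat p A * A) $$ (i, j)"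
      using A ij
      by (simp add: scalar_prod_def atLeast0LessThan eval_mat_eq_mat[OF A **])
    finally show ?case using ij A by (simp add: eval_mat_dims[OF A])
  qed (use A in \<open>auto simp: eval_mat_dims[OF A]\<close>)
qed

lemma eval_mat_0: "A \<in> carrier_mat n n \<Longrightarrow> eval_mat 0 A = 0\<^sub>m n n"
  by (auto simp: eval_mat_eq_mat[where N = 0])

lemma eval_mat_1:
  fixes A :: "'a::comm_ring_1 mat"
  assumes A: "A \<in> carrier_mat n n"
  shows "eval_mat 1 A = 1\<^sub>m n"
proof -
  have "1 \<cdot>\<^sub>m 1\<^sub>m n = (1\<^sub>m n :: 'a mat)" by (rule eq_matI) auto
  then show ?thesis
    using eval_mat_pCons[OF A, of 1 0] A by (simp add: eval_mat_0[OF A] one_pCons)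
qed

lemma eval_mat_mult:
  assumes A: "A \<in> carrier_mat n n"
  shows "eval_mat (p * q) A = eval_mat p A * eval_mat q A"
proof (induction q)
  case 0
  show ?case using eval_mat_carrier[OF A, of p] by (simp add: eval_mat_0[OF A])
next
  case (pCons a q)
  note c = eval_mat_carrier[OF A, of p] eval_mat_carrier[OF A, of q]
  have "eval_mat (p * pCons a q) A = a \<cdot>\<^sub>m eval_mat p A + eval_mat (pCons 0 (p * q)) A"
    by (simp add: mult_pCons_right eval_mat_add[OF A] eval_mat_smult[OF A])
  also have "eval_mat (pCons 0 (p * q)) A = eval_mat p A * (eval_mat q A * A)"
  proof -
    have "0 \<cdot>\<^sub>m 1\<^sub>m n + eval_mat p A * eval_mat q A * A = eval_mat p A * eval_mat q A * A"
      by (rule eq_matI) (use A in \<open>auto simp: eval_mat_dims[OF A]\<close>)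
    also have "\<dots> = eval_mat p A * (eval_mat q A * A)"
      by (rule assoc_mult_mat[OF c A])
    finally show ?thesis by (simp add: eval_mat_pCons[OF A] pCons.IH)
  qed
  also have "a \<cdot>\<^sub>m eval_mat p A = eval_mat p A * (a \<cdot>\<^sub>m 1\<^sub>m n)"
    by (subst mult_smult_distrib[OF c(1) one_carrier_mat]) (simp add: right_mult_one_mat[OF c(1)])
  also have "\<dots> + eval_mat p A * (eval_mat q A * A)
      = eval_mat p A * (a \<cdot>\<^sub>m 1\<^sub>m n + eval_mat q A * A)"
    by (rule mult_add_distrib_mat[OF c(1), symmetric])
       (auto intro: mult_carrier_mat[OF c(2) A])
  finally show ?case by (simp add: eval_mat_pCons[OF A])
qed

lemma eval_mat_monom:
  assumes A: "A \<in> carrier_mat n n"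
  shows "eval_mat (monom 1 k) A = A ^\<^sub>m k"
  using A by (intro eq_matI)
    (auto simp: eval_mat_eq_mat[where N = k and n = n] if_distrib[of "\<lambda>x. x * _"] cong: if_cong)

lemma eval_mat_ring_hom:
  fixes A :: "'a::comm_ring_1 mat"
  assumes A: "A \<in> carrier_mat n n"
  shows "(\<lambda>f. eval_mat f A) \<in> Ring.ring_hom poly_ring (ring_mat TYPE('a) n ())"
  by (rule ring_hom_memI)
     (auto simp: poly_ring_simps ring_mat_simps A eval_mat_add[OF A] eval_mat_mult[OF A]
        eval_mat_1[OF A])

lemma index_mult_mat_sum:
  assumes "A \<in> carrier_mat n n" "B \<in> carrier_mat n n" "i < n" "j < n"
  shows "(A * B) $$ (i, j) = (\<Sum>l<n. A $$ (i, l) * B $$ (l, j))"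
  using assms by (simp add: scalar_prod_def atLeast0LessThan)

section \<open>The last row of polynomials in the companion matrix\<close>

lemma companion_mat_carrier [simp]: "companion_mat g \<in> carrier_mat (degree g) (degree g)"
  by (simp add: companion_mat_def)

text \<open>Multiplication by the companion matrix from the right moves each standard row vector other
  than the first one step up, so it takes \<open>n - 1\<close> steps to bring the last one to the top. This makes
  the last standard row vector a cyclic vector.\<close>

lemma companion_mat_pow_last_row:
  fixes g :: "'a::comm_ring_1 poly"
  assumes "k < degree g" "j < degree g"
  shows "(companion_mat g ^\<^sub>m k) $$ (degree g - 1, j) = (if j = degree g - 1 - k then 1 else 0)"
  using assms
proof (induction k arbitrary: j)
  case 0
  then show ?case using carrier_matD[OF companion_mat_carrier[of g]] by auto
next
  case (Suc k)
  let ?n = "degree g" and ?C = "companion_mat g"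
  have P: "?C ^\<^sub>m k \<in> carrier_mat ?n ?n" by (simp add: pow_carrier_mat)
  have "(?C ^\<^sub>m Suc k) $$ (?n - 1, j) = (\<Sum>l<?n. (?C ^\<^sub>m k) $$ (?n - 1, l) * ?C $$ (l, j))"
    using Suc.prems index_mult_mat_sum[OF P companion_mat_carrier] by simp
  also have "\<dots> = (\<Sum>l<?n. if l = ?n - 1 - k then ?C $$ (l, j) else 0)"
    using Suc by (intro sum.cong) auto
  also have "\<dots> = ?C $$ (?n - 1 - k, j)"
    using Suc.prems by simp
  also have "\<dots> = (if j = ?n - 1 - Suc k then 1 else 0)"
    using Suc.prems by (auto simp: companion_mat_def)
  finally show ?case .
qed

text \<open>After \<open>n - 1\<close> steps the last standard row vector has become the first one, and one further
  multiplication selects the first row of the companion matrix.\<close>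

lemma companion_mat_pow_degree_last_row:
  fixes g :: "'a::comm_ring_1 poly"
  assumes "j < degree g"
  shows "(companion_mat g ^\<^sub>m degree g) $$ (degree g - 1, j) = - coeff g (degree g - 1 - j)"
proof -
  let ?n = "degree g" and ?C = "companion_mat g"
  obtain m where m: "?n = Suc m" using assms by (cases ?n) auto
  have P: "?C ^\<^sub>m m \<in> carrier_mat ?n ?n" by (simp add: pow_carrier_mat)
  have "(?C ^\<^sub>m Suc m) $$ (m, j) = (\<Sum>l<?n. (?C ^\<^sub>m m) $$ (m, l) * ?C $$ (l, j))"
    using assms m index_mult_mat_sum[OF P companion_mat_carrier] by simp
  also have "\<dots> = (\<Sum>l<?n. if l = 0 then ?C $$ (l, j) else 0)"
    using companion_mat_pow_last_row[of m g] m by (intro sum.cong) auto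
  also have "\<dots> = - coeff g (?n - 1 - j)"
    using assms m by (simp add: companion_mat_def)
  finally show ?thesis using m by simp
qed

lemma eval_companion_mat_last_row:
  fixes g :: "'a::comm_ring_1 poly"
  assumes "\<forall>k\<ge>degree g. coeff r k = 0" "k < degree g"
  shows "eval_mat r (companion_mat g) $$ (degree g - 1, degree g - 1 - k) = coeff r k"
proof -
  let ?n = "degree g" and ?C = "companion_mat g"
  have "eval_mat r ?C $$ (?n - 1, ?n - 1 - k)
      = (\<Sum>l\<le>?n - 1. coeff r l * (?C ^\<^sub>m l) $$ (?n - 1, ?n - 1 - k))"
    using assms by (subst eval_mat_eq_mat[where N = "?n - 1" and n = ?n]) auto
  also have "\<dots> = (\<Sum>l\<le>?n - 1. if l = k then coeff r l else 0)"
  proof (intro sum.cong refl)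
    fix l assume "l \<in> {..?n - 1}"
    then have "l < ?n" "?n - 1 - k < ?n" "?n - 1 - k = ?n - 1 - l \<longleftrightarrow> l = k"
      using assms(2) by auto
    then show "coeff r l * (?C ^\<^sub>m l) $$ (?n - 1, ?n - 1 - k) = (if l = k then coeff r l else 0)"
      by (simp only: companion_mat_pow_last_row) simp
  qed
  also have "\<dots> = coeff r k"
    using assms(2) by simp
  finally show ?thesis .
qed

section \<open>The kernel of evaluation at the companion matrix\<close>

lemma eval_companion_mat_eq_0_small:
  fixes g :: "'a::comm_ring_1 poly"
  assumes "\<forall>k\<ge>degree g. coeff r k = 0"
    and "eval_mat r (companion_mat g) = 0\<^sub>m (degree g) (degree g)"
  shows "r = 0"
proof (rule poly_eqI)
  fix k
  show "coeff r k = coeff 0 k"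
    using assms eval_companion_mat_last_row[OF assms(1), of k]
    by (cases "k < degree g") auto
qed

text \<open>The last row vanishes by cancellation; the other rows are obtained from it by
  multiplication with powers of the companion matrix, which commute with the value of \<open>g\<close>.\<close>

lemma eval_companion_mat_self:
  fixes g :: "'a::comm_ring_1 poly"
  assumes "lead_coeff g = 1"
  shows "eval_mat g (companion_mat g) = 0\<^sub>m (degree g) (degree g)"
proof -
  let ?n = "degree g" and ?C = "companion_mat g"
  let ?E = "eval_mat g ?C"
  note C = companion_mat_carrier[of g]
  note E = eval_mat_carrier[OF C, of g]
  have last: "?E $$ (?n - 1, j) = 0" if j: "j < ?n" for j
  proof -
    have "?E $$ (?n - 1, j) = (\<Sum>k\<le>?n. coeff g k * (?C ^\<^sub>m k) $$ (?n - 1, j))"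
      using j by (subst eval_mat_eq_mat[OF C, where N = ?n]) (auto simp: coeff_eq_0)
    also have "\<dots> = (\<Sum>k<?n. coeff g k * (?C ^\<^sub>m k) $$ (?n - 1, j))
        + (?C ^\<^sub>m ?n) $$ (?n - 1, j)"
      using assms by (simp add: lessThan_Suc_atMost[symmetric])
    also have "(\<Sum>k<?n. coeff g k * (?C ^\<^sub>m k) $$ (?n - 1, j))
        = (\<Sum>k<?n. if k = ?n - 1 - j then coeff g k else 0)"
    proof (intro sum.cong refl)
      fix k assume "k \<in> {..<?n}"
      then have "k < ?n" "j = ?n - 1 - k \<longleftrightarrow> k = ?n - 1 - j"
        using j by auto
      then show "coeff g k * (?C ^\<^sub>m k) $$ (?n - 1, j) = (if k = ?n - 1 - j then coeff g k else 0)"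
        using j by (simp only: companion_mat_pow_last_row) simp
    qed
    also have "\<dots> = coeff g (?n - 1 - j)"
      using j by simp
    finally show ?thesis
      using companion_mat_pow_degree_last_row[OF j] by simp
  qed
  show ?thesis
  proof (rule eq_matI, goal_cases)
    case (1 i j)
    then have ij: "i < ?n" "j < ?n" by auto
    \<comment> \<open>\<open>k\<close> is the number of steps that take the last standard row vector to the one of index \<open>i\<close>.\<close>
    define k where "k = ?n - 1 - i"
    have k: "k < ?n" "?n - 1 - k = i" using ij by (auto simp: k_def)
    have P: "?C ^\<^sub>m k \<in> carrier_mat ?n ?n" by (simp add: pow_carrier_mat)
    \<comment> \<open>Both factors are values of polynomials at the same matrix.\<close>
    have comm: "?C ^\<^sub>m k * ?E = ?E * ?C ^\<^sub>m k"
      by (metis C eval_mat_monom eval_mat_mult mult.commute)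
    have "(?C ^\<^sub>m k * ?E) $$ (?n - 1, j)
        = (\<Sum>l<?n. (?C ^\<^sub>m k) $$ (?n - 1, l) * ?E $$ (l, j))"
      using ij index_mult_mat_sum[OF P E] by simp
    also have "\<dots> = (\<Sum>l<?n. if l = i then ?E $$ (l, j) else 0)"
    proof (intro sum.cong refl)
      fix l assume "l \<in> {..<?n}"
      then have "(?C ^\<^sub>m k) $$ (?n - 1, l) = (if l = i then 1 else 0)"
        using companion_mat_pow_last_row[OF k(1), of l] k(2) by simp
      then show "(?C ^\<^sub>m k) $$ (?n - 1, l) * ?E $$ (l, j) = (if l = i then ?E $$ (l, j) else 0)"
        by simp
    qed
    also have "\<dots> = ?E $$ (i, j)"
      using ij by simp
    finally have "?E $$ (i, j) = (?E * ?C ^\<^sub>m k) $$ (?n - 1, j)"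
      by (simp add: comm)
    also have "\<dots> = (\<Sum>l<?n. ?E $$ (?n - 1, l) * (?C ^\<^sub>m k) $$ (l, j))"
      using ij index_mult_mat_sum[OF E P] by simp
    also have "\<dots> = 0"
      using last by simp
    finally show ?case using ij by simp
  qed (simp_all add: eval_mat_dims[OF C])
qed

lemma eval_companion_mat_eq_0_iff:
  fixes g :: "'a::comm_ring_1 poly"
  assumes g: "lead_coeff g = 1"
  shows "eval_mat f (companion_mat g) = 0\<^sub>m (degree g) (degree g) \<longleftrightarrow> g dvd f"
proof -
  let ?n = "degree g" and ?C = "companion_mat g"
  note C = companion_mat_carrier[of g]
  have mult: "eval_mat (g * q) ?C = 0\<^sub>m ?n ?n" for q
    by (simp add: eval_mat_mult[OF C] eval_companion_mat_self[OF g])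
       (rule left_mult_zero_mat[OF eval_mat_carrier[OF C]])
  show ?thesis
  proof
    assume f: "eval_mat f ?C = 0\<^sub>m ?n ?n"
    obtain q r where qr: "f = g * q + r" "\<forall>k\<ge>?n. coeff r k = 0"
      using monic_division_exists[OF g] by blast
    have "eval_mat r ?C = 0\<^sub>m ?n ?n"
      using f eval_mat_carrier[OF C, of r] by (simp add: qr(1) eval_mat_add[OF C] mult)
    then have "r = 0" using qr(2) eval_companion_mat_eq_0_small by blast
    then show "g dvd f" using qr(1) by simp
  next
    assume "g dvd f"
    then show "eval_mat f ?C = 0\<^sub>m ?n ?n" using mult by (auto elim: dvdE)
  qed
qed

section \<open>Coordinates in the monomial basis\<close>

text \<open>The difference of two remainders lies in the kernel of evaluation and is determined by the
  last row of its value. Arguing through the matrix avoids degree computations over a ring with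
  zero divisors.\<close>

lemma monic_small_remainder_unique:
  fixes g :: "'a::comm_ring_1 poly"
  assumes g: "lead_coeff g = 1" and "g dvd r - s"
    and "\<forall>k\<ge>degree g. coeff r k = 0" "\<forall>k\<ge>degree g. coeff s k = 0"
  shows "r = s"
proof -
  have "r - s = 0"
    using assms(3,4) eval_companion_mat_eq_0_iff[OF g, of "r - s"] assms(2)
    by (intro eval_companion_mat_eq_0_small[of g]) auto
  then show ?thesis by simp
qed

lemma quot_coeff_residue_class:
  fixes g :: "'a::comm_ring_1 poly"
  assumes g: "lead_coeff g = 1" and "g dvd r - f" and "\<forall>k\<ge>degree g. coeff r k = 0"
  shows "quot_coeff g (residue_class g f) = coeff r"
proof -
  have "(THE s. s \<in> residue_class g f \<and> (\<forall>k\<ge>degree g. coeff s k = 0)) = r"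
  proof (rule the_equality)
    show "r \<in> residue_class g f \<and> (\<forall>k\<ge>degree g. coeff r k = 0)"
      using assms by (simp add: mem_residue_class_iff)
  next
    fix s assume s: "s \<in> residue_class g f \<and> (\<forall>k\<ge>degree g. coeff s k = 0)"
    then have "g dvd s - r"
      using dvd_diff[of g "s - f" "r - f"] assms(2) by (simp add: mem_residue_class_iff)
    then show "s = r"
      using s assms(3) by (intro monic_small_remainder_unique[OF g]) auto
  qed
  then show ?thesis by (simp add: quot_coeff_def)
qed

lemma residue_class_representative:
  fixes g :: "'a::comm_ring_1 poly"
  assumes g: "lead_coeff g = 1"
  defines "n \<equiv> degree g"
  shows "g dvd f - (\<Sum>k<n. Polynomial.smult (quot_coeff g (residue_class g f) k) (monom 1 k))"
proof -
  obtain q r where qr: "f = g * q + r" "\<forall>k\<ge>n. coeff r k = 0"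
    using monic_division_exists[OF g] unfolding n_def by blast
  have c: "quot_coeff g (residue_class g f) = coeff r"
    using qr by (intro quot_coeff_residue_class[OF g]) (auto simp: n_def)
  have "(\<Sum>k<n. Polynomial.smult (coeff r k) (monom 1 k)) = r"
    using qr(2) by (intro poly_eqI) (auto simp: coeff_sum if_distrib cong: if_cong)
  moreover have "g dvd f - r" using qr(1) by simp
  ultimately show ?thesis by (simp add: c)
qed

text \<open>The coordinates of the class of \<open>f\<close> are the coefficients of its remainder modulo \<open>g\<close>, and
  \<open>f\<close> and its remainder have the same value because \<open>g\<close> evaluates to 0.\<close>

lemma companion_map_residue_class:
  fixes g :: "'a::comm_ring_1 poly"
  assumes g: "lead_coeff g = 1"
  shows "companion_map g (residue_class g f) = eval_mat f (companion_mat g)"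
proof -
  let ?n = "degree g" and ?C = "companion_mat g"
  note C = companion_mat_carrier[of g]
  obtain q r where qr: "f = g * q + r" "\<forall>k\<ge>?n. coeff r k = 0"
    using monic_division_exists[OF g] by blast
  have c: "quot_coeff g (residue_class g f) = coeff r"
    using qr by (intro quot_coeff_residue_class[OF g]) auto
  have P: "?C ^\<^sub>m k \<in> carrier_mat ?n ?n" for k by (rule pow_carrier_mat[OF C])
  have "companion_map g (residue_class g f)
      = mat ?n ?n (\<lambda>(i, j). \<Sum>k<?n. coeff r k * (?C ^\<^sub>m k) $$ (i, j))"
    unfolding companion_map_def c
    using P carrier_matD[OF C]
    by (subst finsum_ring_mat) (auto intro!: eq_matI sum.cong)
  also have "\<dots> = eval_mat r ?C"
    using qr(2) 
    by (subst eval_mat_eq_mat[OF C, where N = ?n])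
       (auto intro!: eq_matI simp: lessThan_Suc_atMost[symmetric])
  also have "\<dots> = eval_mat f ?C"
  proof -
    have "eval_mat (g * q) ?C = 0\<^sub>m ?n ?n"
      by (simp add: eval_companion_mat_eq_0_iff[OF g])
    then show ?thesis
      using eval_mat_carrier[OF C, of r] by (simp add: qr(1) eval_mat_add[OF C])
  qed
  finally show ?thesis .
qed

section \<open>The isomorphism\<close>

lemma companion_ring_simps:
  "carrier (companion_ring g) = range (\<lambda>f. eval_mat f (companion_mat g))"
  "mult (companion_ring g) = (*)" "one (companion_ring g) = 1\<^sub>m (degree g)"
  "zero (companion_ring g) = 0\<^sub>m (degree g) (degree g)" "add (companion_ring g) = (+)"
  by (auto simp: companion_ring_def ring_mat_simps)

text \<open>As the image of a ring homomorphism the companion ring is a ring; it is commutative because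
  products of values are values of products of polynomials.\<close>

lemma cring_companion_ring: "cring (companion_ring (g :: 'a::comm_ring_1 poly))"
proof -
  let ?h = "\<lambda>f. eval_mat f (companion_mat g)"
  note C = companion_mat_carrier[of g]
  interpret P: cring "poly_ring :: 'a poly ring" by (rule cring_poly_ring)
  have "companion_ring g = ring_mat TYPE('a) (degree g) ()
      \<lparr>carrier := ?h ` carrier poly_ring, zero := ?h \<zero>\<^bsub>poly_ring\<^esub>\<rparr>"
    by (auto simp: companion_ring_def ring_mat_def poly_ring_simps eval_mat_0[OF C])
  then have ring: "ring (companion_ring g)"
    using P.ring_hom_imp_img_ring[OF eval_mat_ring_hom[OF C]] by simp
  have comm: "x \<otimes>\<^bsub>companion_ring g\<^esub> y = y \<otimes>\<^bsub>companion_ring g\<^esub> x"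
    if xy: "x \<in> carrier (companion_ring g)" "y \<in> carrier (companion_ring g)" for x y
  proof -
    obtain p q where "x = ?h p" "y = ?h q"
      using xy unfolding companion_ring_simps(1) by blast
    then have "x * y = ?h (p * q)" "y * x = ?h (p * q)"
      by (simp_all add: eval_mat_mult[OF C, symmetric] mult.commute)
    then show ?thesis by (simp add: companion_ring_simps)
  qed
  show ?thesis
    by (intro cring.intro comm_monoid.intro comm_monoid_axioms.intro ring comm
        ring.is_monoid[OF ring])
qed

text \<open>The first isomorphism theorem provides an isomorphism that sends each residue class to the
  only element of its image under evaluation; it agrees with the map given by coordinates.\<close>

lemma companion_map_ring_iso:
  fixes g :: "'a::comm_ring_1 poly"
  assumes g: "lead_coeff g = 1"
  shows "companion_map g \<in> ring_iso (poly_quot g) (companion_ring g)"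
proof -
  let ?h = "\<lambda>f. eval_mat f (companion_mat g)"
  note C = companion_mat_carrier[of g]
  interpret P: cring "poly_ring :: 'a poly ring" by (rule cring_poly_ring)
  have hom: "?h \<in> Ring.ring_hom poly_ring (companion_ring g)"
    by (rule ring_hom_memI)
       (simp_all add: poly_ring_simps companion_ring_simps eval_mat_add[OF C] eval_mat_mult[OF C]
          eval_mat_1[OF C])
  interpret H: ring_hom_ring poly_ring "companion_ring g" ?h
    by (rule ring_hom_ringI2[OF P.ring_axioms cring.axioms(1)[OF cring_companion_ring] hom])
  have ker: "a_kernel poly_ring (companion_ring g) ?h = genideal poly_ring {g}"
    unfolding a_kernel_def' genideal_poly_ring poly_ring_simps companion_ring_simps
      eval_companion_mat_eq_0_iff[OF g] by simp
  have "(\<lambda>X. the_elem (?h ` X)) \<in> ring_iso (poly_quot g) (companion_ring g)"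
    unfolding poly_quot_def ker[symmetric]
    by (rule H.FactRing_iso_set) (simp only: companion_ring_simps poly_ring_simps)
  moreover have "the_elem (?h ` X) = companion_map g X" if X: "X \<in> carrier (poly_quot g)" for X
  proof -
    obtain f where f: "X = residue_class g f"
      using X unfolding poly_quot_def FactRing_def residue_class_def A_RCOSETS_def' by auto
    show ?thesis
      using H.the_elem_simp[of f] unfolding f companion_map_residue_class[OF g]
      unfolding residue_class_def ker poly_ring_simps by blast
  qed
  moreover have "ring (poly_quot g)"
    unfolding poly_quot_def ker[symmetric]
    by (rule ideal.quotient_is_ring[OF H.kernel_is_ideal])
  ultimately show ?thesis using ring.ring_iso_restrict by blast
qed

lemma cring_poly_quot: "cring (poly_quot (g :: 'a::comm_ring_1 poly))"
proof -
  interpret P: cring "poly_ring :: 'a poly ring" by (rule cring_poly_ring)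
  have "ideal (genideal poly_ring {g}) poly_ring"
    by (rule P.genideal_ideal) (simp add: poly_ring_simps)
  then show ?thesis
    unfolding poly_quot_def by (rule ideal.quotient_is_cring) (rule cring_poly_ring)
qed

theorem theorem3p1:
  fixes g :: "'a::comm_ring_1 poly" and n :: nat
  assumes "degree g = n" and "lead_coeff g = 1"
  shows "cring (poly_quot g) \<and> cring (companion_ring g)
    \<and> companion_map g \<in> ring_iso (poly_quot g) (companion_ring g)
    \<and> (\<forall>f. let c = quot_coeff g (residue_class g f) in
          residue_class g f = residue_class g (\<Sum>k<n. Polynomial.smult (c k) (monom 1 k))
        \<and> companion_map g (residue_class g f)
            = (\<Oplus>\<^bsub>ring_mat TYPE('a) n ()\<^esub>k\<in>{..<n}. c k \<cdot>\<^sub>m (companion_mat g ^\<^sub>m k))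
        \<and> companion_map g (residue_class g f) = eval_mat f (companion_mat g))"
proof (intro conjI allI)
  fix f
  show "let c = quot_coeff g (residue_class g f) in
          residue_class g f = residue_class g (\<Sum>k<n. Polynomial.smult (c k) (monom 1 k))
        \<and> companion_map g (residue_class g f)
            = (\<Oplus>\<^bsub>ring_mat TYPE('a) n ()\<^esub>k\<in>{..<n}. c k \<cdot>\<^sub>m (companion_mat g ^\<^sub>m k))
        \<and> companion_map g (residue_class g f) = eval_mat f (companion_mat g)"
    unfolding Let_def assms(1)[symmetric]
    using residue_class_representative[OF assms(2)] companion_map_residue_class[OF assms(2)]
    by (simp add: residue_class_eq_iff companion_map_def)
qed (use assms cring_poly_quot cring_companion_ring companion_map_ring_iso in auto)

end
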